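(* There is a constant $c'$ such that for all positive integers $k$, $R(3,k)\le \operatorname{gr}(AC_6,K_k)\le c'k^3$.
   Context: $R(3,k)$ is the classical graph Ramsey number: the least $n$ such that every graph on $n$ vertices contains a triangle or an independent set of size $k$. A grid subgraph on $c$ columns and $r$ rows is a graph whose vertex set is a subset of $[c]\times[r]$ (vertex $(x,y)$ in column $x$, row $y$) and whose edges each join two vertices in the same row or the same column. $G_{N\times N}=K_N\square K_N$; a spanning grid subgraph is a spanning subgraph of it. An embedding of $H$ (on $c_H$ columns, $r_H$ rows) into $G$ is a pair of injections $\varphi_c:[c_H]\to[N]$, $\varphi_r:[r_H]\to[N]$ sending each edge $\{(x,y),(x',y')\}$ of $H$ to an edge $\{(\varphi_c(x),\varphi_r(y)),(\varphi_c(x'),\varphi_r(y'))\}$ of $G$; $G$ contains $H$ if one exists. A coclique of size $k$ is a set of $k$ pairwise non-adjacent vertices all in one row or all in one column. $\operatorname{gr}(H,K_k)$ is the least $N$ such that every spanning grid subgraph of $G_{N\times N}$ contains $H$ or a coclique of size $k$. $AC_6$ is the grid subgraph on $3$ columns and $3$ rows which is the $6$-cycle through $(1,1),(2,1),(2,2),(3,2),(3,3),(1,3)$ in this order. *)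

theory Defs
  imports "HOL-Library.Ramsey" "HOL-Library.Extended_Real"
begin

text \<open>
  Both Ramsey-type numbers below are infima in \<^typ>\<open>enat\<close>: the value is the least
  natural number with the property if there is one, and infinity otherwise.
\<close>

definition ramsey_property :: "nat \<Rightarrow> nat \<Rightarrow> nat \<Rightarrow> bool" where
  "ramsey_property l k n \<longleftrightarrow>
     (\<forall>E \<subseteq> nsets {1..n} 2.
        (\<exists>S \<subseteq> {1..n}. card S = l \<and> clique S E) \<or>
        (\<exists>S \<subseteq> {1..n}. card S = k \<and> indep S E))"

definition ramsey_number :: "nat \<Rightarrow> nat \<Rightarrow> enat" where
  "ramsey_number l k = Inf {enat n | n. ramsey_property l k n}"

text \<open>A vertex \<open>(x, y)\<close> lies in column \<open>x\<close> and row \<open>y\<close>; both are counted from 1.\<close>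

record grid_graph =
  ncols :: nat
  nrows :: nat
  verts :: "(nat \<times> nat) set"
  edges :: "(nat \<times> nat) set set"

definition same_line :: "nat \<times> nat \<Rightarrow> nat \<times> nat \<Rightarrow> bool" where
  "same_line u v \<longleftrightarrow> fst u = fst v \<or> snd u = snd v"

definition grid_subgraph :: "grid_graph \<Rightarrow> bool" where
  "grid_subgraph G \<longleftrightarrow>
     verts G \<subseteq> {1..ncols G} \<times> {1..nrows G} \<and>
     edges G \<subseteq> {{u, v} | u v. u \<in> verts G \<and> v \<in> verts G \<and> u \<noteq> v \<and> same_line u v}"

definition full_grid :: "nat \<Rightarrow> grid_graph" where
  "full_grid N =
     \<lparr>ncols = N, nrows = N, verts = {1..N} \<times> {1..N},
      edges = {{u, v} | u v. u \<in> {1..N} \<times> {1..N} \<and> v \<in> {1..N} \<times> {1..N} \<and>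
                             u \<noteq> v \<and> same_line u v}\<rparr>"

definition spanning_grid_subgraph :: "nat \<Rightarrow> grid_graph \<Rightarrow> bool" where
  "spanning_grid_subgraph N G \<longleftrightarrow>
     ncols G = ncols (full_grid N) \<and> nrows G = nrows (full_grid N) \<and>
     verts G = verts (full_grid N) \<and> edges G \<subseteq> edges (full_grid N)"

definition grid_embedding ::
  "grid_graph \<Rightarrow> grid_graph \<Rightarrow> (nat \<Rightarrow> nat) \<Rightarrow> (nat \<Rightarrow> nat) \<Rightarrow> bool" where
  "grid_embedding H G \<phi>\<^sub>c \<phi>\<^sub>r \<longleftrightarrow>
     \<phi>\<^sub>c ` {1..ncols H} \<subseteq> {1..ncols G} \<and> inj_on \<phi>\<^sub>c {1..ncols H} \<and>
     \<phi>\<^sub>r ` {1..nrows H} \<subseteq> {1..nrows G} \<and> inj_on \<phi>\<^sub>r {1..nrows H} \<and>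
     (\<forall>x y x' y'. {(x, y), (x', y')} \<in> edges H \<longrightarrow>
        {(\<phi>\<^sub>c x, \<phi>\<^sub>r y), (\<phi>\<^sub>c x', \<phi>\<^sub>r y')} \<in> edges G)"

definition grid_contains :: "grid_graph \<Rightarrow> grid_graph \<Rightarrow> bool" where
  "grid_contains G H \<longleftrightarrow> (\<exists>\<phi>\<^sub>c \<phi>\<^sub>r. grid_embedding H G \<phi>\<^sub>c \<phi>\<^sub>r)"

definition coclique :: "grid_graph \<Rightarrow> nat \<Rightarrow> (nat \<times> nat) set \<Rightarrow> bool" where
  "coclique G k S \<longleftrightarrow>
     S \<subseteq> verts G \<and> finite S \<and> card S = k \<and> indep S (edges G) \<and>
     ((\<exists>x. \<forall>v\<in>S. fst v = x) \<or> (\<exists>y. \<forall>v\<in>S. snd v = y))"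

definition grid_ramsey_property :: "grid_graph \<Rightarrow> nat \<Rightarrow> nat \<Rightarrow> bool" where
  "grid_ramsey_property H k N \<longleftrightarrow>
     (\<forall>G. spanning_grid_subgraph N G \<longrightarrow> grid_contains G H \<or> (\<exists>S. coclique G k S))"

definition gr :: "grid_graph \<Rightarrow> nat \<Rightarrow> enat" where
  "gr H k = Inf {enat N | N. grid_ramsey_property H k N}"

definition AC6 :: grid_graph where
  "AC6 =
     \<lparr>ncols = 3, nrows = 3,
      verts = {(1,1), (2,1), (2,2), (3,2), (3,3), (1,3)},
      edges = {{(1,1), (2,1)}, {(2,1), (2,2)}, {(2,2), (3,2)},
               {(3,2), (3,3)}, {(3,3), (1,3)}, {(1,3), (1,1)}}\<rparr>"

lemma grid_subgraph_AC6: "grid_subgraph AC6"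
proof -
  have edge: "{u, v} \<in> {{u, v} | u v. u \<in> V \<and> v \<in> V \<and> u \<noteq> v \<and> same_line u v}"
    if "u \<in> V" "v \<in> V" "u \<noteq> v" "same_line u v" for u v :: "nat \<times> nat" and V
    using that by blast
  show ?thesis
    unfolding grid_subgraph_def AC6_def grid_graph.simps insert_subset
    by (intro conjI edge empty_subsetI) (simp_all add: same_line_def)
qed

lemma spanning_grid_subgraph_imp_grid_subgraph:
  "spanning_grid_subgraph N G \<Longrightarrow> grid_subgraph G"
  by (auto simp: spanning_grid_subgraph_def grid_subgraph_def full_grid_def)

end

theory Submission
  imports Defs
begin

text \<open>
  Lower bound: copy a triangle-free graph without independent \<open>k\<close>-sets into every row and every
  column; the three row edges of an alternating hexagon project to a triangle.

  Upper bound: suppose that no line has a coclique of size \<open>k\<close>. Fix a column \<open>a\<close> and a row \<open>s\<close>, and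
  let \<open>M\<close> be the set of pairs \<open>(r, b)\<close> such that \<open>(a, r), (b, r)\<close> are adjacent and
  \<open>(b, r), (b, s)\<close> are adjacent. Two pairs \<open>(r, b)\<close>, \<open>(r', b')\<close> of \<open>M\<close> with \<open>r r'\<close> an edge of column
  \<open>a\<close> and \<open>b b'\<close> an edge of row \<open>s\<close> form an alternating hexagon. Without one, \<open>M\<close> is independent in
  the tensor product of two graphs on \<open>N\<close> vertices with independence number below \<open>k\<close>, and hence
  has at most \<open>2kN\<close> elements. On the other hand most vertices have degree of order \<open>N/k\<close> in their
  row and in their column, so that on average \<open>M\<close> has order \<open>N\<^sup>2/k\<^sup>2\<close> elements. This is impossible
  when \<open>N\<close> is a large multiple of \<open>k\<^sup>3\<close>.
\<close>

section \<open>Graphs with small independence number\<close>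

text \<open>Take \<open>S\<close> maximal under inclusion among the independent subsets of
  \<open>U\<close>: a vertex it failed to dominate could be added.\<close>

lemma indep_dominating_set_exists:
  assumes "finite U"
  obtains S where "S \<subseteq> U" "indep S E" "\<And>u. u \<in> U \<Longrightarrow> u \<in> S \<or> (\<exists>s\<in>S. {s, u} \<in> E)"
proof -
  let ?F = "{S. S \<subseteq> U \<and> indep S E}"
  have "finite ?F" using assms by simp
  moreover have "{} \<in> ?F" by (simp add: indep_def)
  ultimately obtain S where S: "S \<in> ?F" and max: "\<forall>T\<in>?F. S \<subseteq> T \<longrightarrow> S = T"
    using finite_has_maximal[of ?F] by blast
  have "u \<in> S \<or> (\<exists>s\<in>S. {s, u} \<in> E)" if "u \<in> U" for u
  proof (rule ccontr)
    assume no: "\<not> (u \<in> S \<or> (\<exists>s\<in>S. {s, u} \<in> E))"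
    then have "insert u S \<in> ?F"
      using S \<open>u \<in> U\<close> by (auto simp: indep_def insert_commute)
    then have "S = insert u S" using max by blast
    then show False using no by blast
  qed
  then show thesis using that S by blast
qed

text \<open>A dominating independent set of the low-degree vertices has at most \<open>k\<close>
  members, and their closed neighbourhoods cover all low-degree vertices. The strict bound on the
  degree leaves room for the vertex itself in each neighbourhood.\<close>

lemma card_low_degree_le:
  assumes fin: "finite V" and alpha: "\<And>S. S \<subseteq> V \<Longrightarrow> indep S E \<Longrightarrow> card S \<le> k"
  shows "card {v \<in> V. card {w \<in> V. {v, w} \<in> E} < t} \<le> k * t"
proof -
  let ?U = "{v \<in> V. card {w \<in> V. {v, w} \<in> E} < t}"
  obtain S where S: "S \<subseteq> ?U" "indep S E"
    and dom: "\<And>u. u \<in> ?U \<Longrightarrow> u \<in> S \<or> (\<exists>s\<in>S. {s, u} \<in> E)"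
    using indep_dominating_set_exists[of ?U E] fin by auto
  have finS: "finite S" using S(1) fin finite_subset by fastforce
  have "?U \<subseteq> (\<Union>s\<in>S. insert s {w \<in> V. {s, w} \<in> E})" using dom by blast
  then have "card ?U \<le> card (\<Union>s\<in>S. insert s {w \<in> V. {s, w} \<in> E})"
    using finS fin by (intro card_mono) auto
  also have "\<dots> \<le> (\<Sum>s\<in>S. card (insert s {w \<in> V. {s, w} \<in> E}))"
    using finS by (rule card_UN_le)
  also have "\<dots> \<le> (\<Sum>s\<in>S. t)"
  proof (rule sum_mono)
    fix s assume "s \<in> S"
    then have "card {w \<in> V. {s, w} \<in> E} < t" using S(1) by auto
    then show "card (insert s {w \<in> V. {s, w} \<in> E}) \<le> t"
      using fin by (simp add: card_insert_if)
  qed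
  also have "\<dots> \<le> k * t" using alpha[of S] S by auto
  finally show ?thesis .
qed

lemma card_Collect_pair_le:
  assumes "finite A" "\<And>a. a \<in> A \<Longrightarrow> finite {b. P a b}" "\<And>a. a \<in> A \<Longrightarrow> card {b. P a b} \<le> m"
  shows "card {(a, b). a \<in> A \<and> P a b} \<le> card A * m"
proof -
  have "{(a, b). a \<in> A \<and> P a b} = (SIGMA a:A. {b. P a b})" by auto
  then have "card {(a, b). a \<in> A \<and> P a b} = (\<Sum>a\<in>A. card {b. P a b})"
    using assms by (simp add: card_SigmaI)
  also have "\<dots> \<le> card A * m" using sum_bounded_above[OF assms(3)] by simp
  finally show ?thesis .
qed

lemma card_Collect_pair_le_swap:
  assumes "finite B" "\<And>b. b \<in> B \<Longrightarrow> finite {a. P a b}" "\<And>b. b \<in> B \<Longrightarrow> card {a. P a b} \<le> m"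
  shows "card {(a, b). b \<in> B \<and> P a b} \<le> card B * m"
proof -
  have "{(a, b). b \<in> B \<and> P a b} = prod.swap ` {(b, a). b \<in> B \<and> P a b}" by auto
  then have "card {(a, b). b \<in> B \<and> P a b} = card {(b, a). b \<in> B \<and> P a b}"
    by (simp add: card_image)
  then show ?thesis using card_Collect_pair_le[of B "\<lambda>b a. P a b" m] assms by simp
qed

lemma card_indep_tensor_product_le:
  assumes finV: "finite V" and finW: "finite W" and M: "M \<subseteq> V \<times> W"
    and alphaV: "\<And>S. S \<subseteq> V \<Longrightarrow> indep S E \<Longrightarrow> card S \<le> k"
    and alphaW: "\<And>S. S \<subseteq> W \<Longrightarrow> indep S F \<Longrightarrow> card S \<le> k"
    and no: "\<And>a b a' b'. (a, b) \<in> M \<Longrightarrow> (a', b') \<in> M \<Longrightarrow> {a, a'} \<in> E \<Longrightarrow> {b, b'} \<notin> F"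
  shows "card M \<le> card V * k + card W * k"
proof -
  \<comment> \<open>Split \<open>M\<close> according to whether \<open>b\<close> is isolated in the slice of \<open>M\<close> at \<open>a\<close>: the isolated
    vertices of a slice over \<open>a\<close> are independent, and so are the remaining \<open>a\<close> over a fixed \<open>b\<close>.\<close>
  let ?iso = "\<lambda>a b. (a, b) \<in> M \<and> (\<forall>b'. (a, b') \<in> M \<longrightarrow> {b, b'} \<notin> F)"
  let ?non = "\<lambda>a b. (a, b) \<in> M \<and> (\<exists>b'. (a, b') \<in> M \<and> {b, b'} \<in> F)"
  let ?I = "{(a, b). a \<in> V \<and> ?iso a b}" and ?J = "{(a, b). b \<in> W \<and> ?non a b}"
  have I: "card ?I \<le> card V * k"
  proof (rule card_Collect_pair_le[OF finV])
    fix a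
    have sub: "{b. ?iso a b} \<subseteq> W" using M by auto
    then show "finite {b. ?iso a b}" using finW finite_subset by blast
    have "indep {b. ?iso a b} F" by (auto simp: indep_def)
    then show "card {b. ?iso a b} \<le> k" using alphaW sub by blast
  qed
  have J: "card ?J \<le> card W * k"
  proof (rule card_Collect_pair_le_swap[OF finW])
    fix b
    have sub: "{a. ?non a b} \<subseteq> V" using M by auto
    then show "finite {a. ?non a b}" using finV finite_subset by blast
    \<comment> \<open>If \<open>a\<close>, \<open>a'\<close> were adjacent members and
      \<open>b'\<close> a neighbour of \<open>b\<close> in the slice at \<open>a\<close>, then
      \<open>(a', b)\<close> and \<open>(a, b')\<close> would contradict \<open>no\<close>.\<close>
    have "indep {a. ?non a b} E"
      unfolding indep_def using no by (auto simp: insert_commute)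
    then show "card {a. ?non a b} \<le> k" using alphaV sub by blast
  qed
  have eq: "?I \<union> ?J = M" using M by auto
  have "card M \<le> card ?I + card ?J" using card_Un_le[of ?I ?J] unfolding eq .
  then show ?thesis using I J by linarith
qed

section \<open>Rows and columns of a grid graph\<close>

definition row_graph :: "grid_graph \<Rightarrow> nat \<Rightarrow> nat set set" where
  "row_graph G y = {e. (\<lambda>x. (x, y)) ` e \<in> edges G}"

definition col_graph :: "grid_graph \<Rightarrow> nat \<Rightarrow> nat set set" where
  "col_graph G x = {e. Pair x ` e \<in> edges G}"

lemma mem_row_graph [simp]: "{a, b} \<in> row_graph G y \<longleftrightarrow> {(a, y), (b, y)} \<in> edges G"
  by (simp add: row_graph_def)

lemma mem_col_graph [simp]: "{a, b} \<in> col_graph G x \<longleftrightarrow> {(x, a), (x, b)} \<in> edges G"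
  by (simp add: col_graph_def)

lemma coclique_of_indep_row:
  assumes "verts G = {1..N} \<times> {1..N}" "y \<in> {1..N}" "S \<subseteq> {1..N}" "indep S (row_graph G y)" "card S = k"
  shows "coclique G k ((\<lambda>x. (x, y)) ` S)"
proof -
  have "finite S" using assms(3) finite_subset by blast
  moreover have "card ((\<lambda>x. (x, y)) ` S) = k"
    using assms(5) by (subst card_image) (auto simp: inj_on_def)
  ultimately show ?thesis using assms unfolding coclique_def indep_def by auto
qed

lemma coclique_of_indep_col:
  assumes "verts G = {1..N} \<times> {1..N}" "x \<in> {1..N}" "S \<subseteq> {1..N}" "indep S (col_graph G x)" "card S = k"
  shows "coclique G k (Pair x ` S)"
proof -
  have "finite S" using assms(3) finite_subset by blast
  moreover have "card (Pair x ` S) = k"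
    using assms(5) by (subst card_image) (auto simp: inj_on_def)
  ultimately show ?thesis using assms unfolding coclique_def indep_def by auto
qed

text \<open>A \<open>coclique\<close> has exactly \<open>k\<close> vertices, so larger independent
  sets must be cut down.\<close>

lemma indep_subset_card:
  assumes "indep S E" "k \<le> card S"
  obtains T where "T \<subseteq> S" "card T = k" "indep T E"
proof -
  obtain T where "T \<subseteq> S" "card T = k"
    using obtain_subset_with_card_n[OF assms(2)] by blast
  then show thesis using that assms(1) unfolding indep_def by blast
qed

lemma edge_endpoints:
  assumes "spanning_grid_subgraph N G" "{u, v} \<in> edges G"
  shows "u \<in> {1..N} \<times> {1..N}" "v \<in> {1..N} \<times> {1..N}" "u \<noteq> v"
proof -
  have "{u, v} \<in> edges (full_grid N)"
    using assms unfolding spanning_grid_subgraph_def by blast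
  then obtain u' v' where "{u, v} = {u', v'}" "u' \<in> {1..N} \<times> {1..N}" "v' \<in> {1..N} \<times> {1..N}" "u' \<noteq> v'"
    unfolding full_grid_def by auto
  then show "u \<in> {1..N} \<times> {1..N}" "v \<in> {1..N} \<times> {1..N}" "u \<noteq> v"
    by (auto simp: doubleton_eq_iff)
qed

text \<open>Edges are not loops: the three row edges make \<open>a\<close>, \<open>b\<close>,
  \<open>c\<close> distinct and the three column edges make \<open>r\<close>, \<open>s\<close>,
  \<open>q\<close> distinct, so both maps are injective.\<close>

lemma grid_contains_AC6I:
  assumes sp: "spanning_grid_subgraph N G"
    and ed: "{(a, r), (b, r)} \<in> edges G" "{(b, r), (b, s)} \<in> edges G" "{(b, s), (c, s)} \<in> edges G"
      "{(c, s), (c, q)} \<in> edges G" "{(c, q), (a, q)} \<in> edges G" "{(a, q), (a, r)} \<in> edges G"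
  shows "grid_contains G AC6"
proof -
  have three: "{Suc 0..3} = {Suc 0, 2, 3}" by auto
  have N: "ncols G = N" "nrows G = N"
    using sp by (auto simp: spanning_grid_subgraph_def full_grid_def)
  let ?c = "\<lambda>i::nat. if i = 1 then a else if i = 2 then b else c"
  let ?r = "\<lambda>i::nat. if i = 1 then r else if i = 2 then s else q"
  have edge: "{(?c x, ?r y), (?c x', ?r y')} \<in> edges G"
    if "{(x, y), (x', y')} \<in> edges AC6" for x y x' y'
  proof -
    \<comment> \<open>Mapping whole edges as sets leaves six cases, with no choice of
      orientation.\<close>
    have "(\<lambda>(x, y). (?c x, ?r y)) ` e \<in> edges G" if "e \<in> edges AC6" for e
      using that ed unfolding AC6_def by auto
    from this[OF that] show ?thesis by simp
  qed
  have "grid_embedding AC6 G ?c ?r"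
    unfolding grid_embedding_def
  proof (intro conjI allI impI edge)
    show "?c ` {1..ncols AC6} \<subseteq> {1..ncols G}" "?r ` {1..nrows AC6} \<subseteq> {1..nrows G}"
      using ed[THEN edge_endpoints(1)[OF sp]] by (auto simp: N AC6_def)
    show "inj_on ?c {1..ncols AC6}" "inj_on ?r {1..nrows AC6}"
      using ed[THEN edge_endpoints(3)[OF sp]] by (auto simp: three AC6_def)
  qed
  then show ?thesis unfolding grid_contains_def by blast
qed

section \<open>The upper bound\<close>

lemma grid_ramsey_property_AC6:
  assumes k: "k > 0"
  shows "grid_ramsey_property AC6 k (128 * k ^ 3)"
  unfolding grid_ramsey_property_def
proof (intro allI impI)
  fix G
  \<comment> \<open>\<open>N = 4 * k * t\<close> makes at most half of the vertices have degree
    below \<open>t\<close> in their row or column. The final count needs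
    \<open>t * t > 4 * k * N\<close>, that is \<open>t > 16 * k ^ 2\<close>; the chosen
    \<open>t\<close> is twice this threshold.\<close>
  define N where "N = 128 * k ^ 3"
  define t where "t = 32 * k ^ 2"
  assume "spanning_grid_subgraph (128 * k ^ 3) G"
  then have sp: "spanning_grid_subgraph N G" by (simp add: N_def)
  then have vG: "verts G = {1..N} \<times> {1..N}"
    by (simp add: spanning_grid_subgraph_def full_grid_def)
  let ?V = "{1..N}"
  have cardV: "card ?V = N" by simp
  show "grid_contains G AC6 \<or> (\<exists>S. coclique G k S)"
  proof (rule ccontr)
    assume neg: "\<not> (grid_contains G AC6 \<or> (\<exists>S. coclique G k S))"
    have alphaR: "card S \<le> k" if y: "y \<in> ?V" and S: "S \<subseteq> ?V" "indep S (row_graph G y)" for S y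
    proof (rule ccontr)
      assume "\<not> card S \<le> k"
      then obtain T where "T \<subseteq> S" "card T = k" "indep T (row_graph G y)"
        using indep_subset_card[OF S(2), of k] by auto
      then show False using coclique_of_indep_row[OF vG y, of T k] S(1) neg by blast
    qed
    have alphaC: "card S \<le> k" if x: "x \<in> ?V" and S: "S \<subseteq> ?V" "indep S (col_graph G x)" for S x
    proof (rule ccontr)
      assume "\<not> card S \<le> k"
      then obtain T where "T \<subseteq> S" "card T = k" "indep T (col_graph G x)"
        using indep_subset_card[OF S(2), of k] by auto
      then show False using coclique_of_indep_col[OF vG x, of T k] S(1) neg by blast
    qed
    let ?rd = "\<lambda>b r. card {a \<in> ?V. {b, a} \<in> row_graph G r}"
    let ?cd = "\<lambda>b r. card {s \<in> ?V. {r, s} \<in> col_graph G b}"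
    \<comment> \<open>For fixed \<open>(a, s)\<close> the related pairs \<open>(r, b)\<close> form
      the set \<open>M\<close>. The row comes first in them, since \<open>M\<close> lives on the
      column graph of \<open>a\<close> times the row graph of \<open>s\<close>.\<close>
    let ?P = "\<lambda>(a, s) (r, b). {(b, r), (a, r)} \<in> edges G \<and> {(b, r), (b, s)} \<in> edges G"

    have upper: "card {q \<in> ?V \<times> ?V. ?P p q} \<le> 2 * k * N" if p_in: "p \<in> ?V \<times> ?V" for p
    proof -
      obtain a s where p: "p = (a, s)" "a \<in> ?V" "s \<in> ?V" using p_in by blast
      have "card {q \<in> ?V \<times> ?V. ?P p q} \<le> card ?V * k + card ?V * k"
      proof (rule card_indep_tensor_product_le[where E = "col_graph G a" and F = "row_graph G s"])
        fix r b r' b'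
        assume M: "(r, b) \<in> {q \<in> ?V \<times> ?V. ?P p q}" "(r', b') \<in> {q \<in> ?V \<times> ?V. ?P p q}"
          and e: "{r, r'} \<in> col_graph G a"
        show "{b, b'} \<notin> row_graph G s"
        proof
          assume "{b, b'} \<in> row_graph G s"
          \<comment> \<open>The hexagon runs through \<open>(a, r)\<close>, \<open>(b, r)\<close>,
            \<open>(b, s)\<close>, \<open>(b', s)\<close>, \<open>(b', r')\<close>,
            \<open>(a, r')\<close>.\<close>
          then have "grid_contains G AC6"
            using M e by (intro grid_contains_AC6I[OF sp, of a r b s b' r'])
              (auto simp: p insert_commute)
          then show False using neg by blast
        qed
      qed (use alphaR alphaC p in auto)
      then show ?thesis by (simp add: algebra_simps)
    qed
    \<comment> \<open>Double counting of the pairs related by \<open>?P\<close>.\<close>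
    have "(\<Sum>q\<in>?V \<times> ?V. card {p \<in> ?V \<times> ?V. ?P p q}) = (\<Sum>p\<in>?V \<times> ?V. card {q \<in> ?V \<times> ?V. ?P p q})"
      using sum.swap_restrict[of "?V \<times> ?V" "?V \<times> ?V" "\<lambda>_ _. 1::nat" ?P] by simp
    also have "\<dots> \<le> card (?V \<times> ?V) * (2 * k * N)"
      using sum_bounded_above[OF upper, of "?V \<times> ?V" "\<lambda>x. x"] by simp
    finally have total: "(\<Sum>q\<in>?V \<times> ?V. card {p \<in> ?V \<times> ?V. ?P p q}) \<le> N * N * (2 * k * N)" by simp

    let ?LR = "{(r, b). r \<in> ?V \<and> b \<in> ?V \<and> ?rd b r < t}"
    let ?LC = "{(r, b). b \<in> ?V \<and> r \<in> ?V \<and> ?cd b r < t}"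
    let ?good = "?V \<times> ?V - (?LR \<union> ?LC)"
    have "card ?LR \<le> card ?V * (k * t)"
      by (rule card_Collect_pair_le) (simp, simp, blast intro: card_low_degree_le alphaR finite_atLeastAtMost)
    moreover have "card ?LC \<le> card ?V * (k * t)"
      by (rule card_Collect_pair_le_swap) (simp, simp, blast intro: card_low_degree_le alphaC finite_atLeastAtMost)
    moreover have "card (?LR \<union> ?LC) \<le> card ?LR + card ?LC" by (rule card_Un_le)
    moreover have "4 * (k * t) = N" by (simp add: N_def t_def power3_eq_cube power2_eq_square)
    then have "4 * (N * (k * t)) = N * N" by (metis mult.left_commute)
    ultimately have bad: "2 * card (?LR \<union> ?LC) \<le> N * N" unfolding cardV by linarith
    have "card ?good = card (?V \<times> ?V) - card (?LR \<union> ?LC)"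
      by (rule card_Diff_subset) (auto intro: finite_subset[of _ "?V \<times> ?V"])
    then have good: "N * N \<le> 2 * card ?good"
      using bad unfolding card_cartesian_product cardV by linarith

    have deg: "t * t \<le> card {p \<in> ?V \<times> ?V. ?P p q}" if q: "q \<in> ?good" for q
    proof -
      obtain r b where rb: "q = (r, b)" by force
      \<comment> \<open>For fixed \<open>(r, b)\<close> the choices of \<open>a\<close> and
        \<open>s\<close> are independent: a row neighbour and a column neighbour of the vertex
        \<open>(b, r)\<close>.\<close>
      have "{p \<in> ?V \<times> ?V. ?P p q} =
          {a \<in> ?V. {b, a} \<in> row_graph G r} \<times> {s \<in> ?V. {r, s} \<in> col_graph G b}"
        unfolding rb by auto
      then have "card {p \<in> ?V \<times> ?V. ?P p q} = ?rd b r * ?cd b r"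
        by (simp only: card_cartesian_product)
      moreover have "t \<le> ?rd b r" "t \<le> ?cd b r" using q rb by auto
      ultimately show ?thesis using mult_le_mono by presburger
    qed
    have "card ?good * (t * t) \<le> (\<Sum>q\<in>?good. card {p \<in> ?V \<times> ?V. ?P p q})"
      using sum_bounded_below[of ?good "t * t"] deg by auto
    also have "\<dots> \<le> (\<Sum>q\<in>?V \<times> ?V. card {p \<in> ?V \<times> ?V. ?P p q})"
      by (rule sum_mono2) auto
    finally have "card ?good * (t * t) \<le> N * N * (2 * k * N)" using total by linarith
    moreover have "N * N * (t * t) \<le> 2 * card ?good * (t * t)" using good by (rule mult_le_mono1)
    ultimately have "N * N * (t * t) \<le> N * N * (4 * k * N)" by linarith
    moreover have "N > 0" using k by (simp add: N_def)
    ultimately have "t * t \<le> 4 * k * N" by simp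
    moreover have "t * t = 2 * (4 * k * N)"
      by (simp add: N_def t_def power3_eq_cube power2_eq_square)
    ultimately show False using \<open>N > 0\<close> k by simp
  qed
qed

section \<open>The lower bound\<close>

text \<open>This is the Cartesian product of the graph \<open>E\<close> on \<open>{1..N}\<close>
  with itself.\<close>

definition line_copies :: "nat \<Rightarrow> nat set set \<Rightarrow> grid_graph" where
  "line_copies N E =
     \<lparr>ncols = N, nrows = N, verts = {1..N} \<times> {1..N},
      edges = {{(x, y), (x', y)} | x x' y. y \<in> {1..N} \<and> {x, x'} \<in> E} \<union>
              {{(x, y), (x, y')} | x y y'. x \<in> {1..N} \<and> {y, y'} \<in> E}\<rparr>"

lemma nsets_2_edge:
  assumes "E \<subseteq> nsets V 2" "{x, x'} \<in> E"
  shows "x \<in> V" "x' \<in> V" "x \<noteq> x'"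
  using assms unfolding nsets_def by (auto simp: card_insert_if split: if_splits)

lemma spanning_line_copies:
  assumes "E \<subseteq> nsets {1..N} 2"
  shows "spanning_grid_subgraph N (line_copies N E)"
proof -
  have "edges (line_copies N E) \<subseteq> edges (full_grid N)"
  proof
    fix e assume "e \<in> edges (line_copies N E)"
    then consider (row) x x' y where "e = {(x, y), (x', y)}" "y \<in> {1..N}" "{x, x'} \<in> E"
      | (col) x y y' where "e = {(x, y), (x, y')}" "x \<in> {1..N}" "{y, y'} \<in> E"
      unfolding line_copies_def by auto
    then show "e \<in> edges (full_grid N)"
    proof cases
      case row
      then show ?thesis using nsets_2_edge[OF assms row(3)]
        unfolding full_grid_def grid_graph.simps
        by (intro CollectI exI[of _ "(x, y)"] exI[of _ "(x', y)"]) (simp add: same_line_def)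
    next
      case col
      then show ?thesis using nsets_2_edge[OF assms col(3)]
        unfolding full_grid_def grid_graph.simps
        by (intro CollectI exI[of _ "(x, y)"] exI[of _ "(x, y')"]) (simp add: same_line_def)
    qed
  qed
  then show ?thesis
    by (simp add: spanning_grid_subgraph_def) (simp add: line_copies_def full_grid_def)
qed

text \<open>An edge from a column copy has both ends in one column, which
  \<open>x \<noteq> x'\<close> excludes.\<close>

lemma row_edge_line_copies:
  assumes "{(x, y), (x', y)} \<in> edges (line_copies N E)" "x \<noteq> x'"
  shows "{x, x'} \<in> E"
  using assms unfolding line_copies_def by (auto simp: doubleton_eq_iff insert_commute)

lemma ramsey_property_of_grid_ramsey_property:
  assumes "grid_ramsey_property AC6 k N"
  shows "ramsey_property 3 k N"
  unfolding ramsey_property_def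
proof (intro allI impI)
  fix E :: "nat set set"
  assume E: "E \<subseteq> nsets {1..N} 2"
  let ?G = "line_copies N E"
  have "grid_contains ?G AC6 \<or> (\<exists>S. coclique ?G k S)"
    using assms spanning_line_copies[OF E] unfolding grid_ramsey_property_def by blast
  then show "(\<exists>S\<subseteq>{1..N}. card S = 3 \<and> clique S E) \<or> (\<exists>S\<subseteq>{1..N}. card S = k \<and> indep S E)"
  proof
    assume "grid_contains ?G AC6"
    then obtain f g where emb: "grid_embedding AC6 ?G f g"
      unfolding grid_contains_def by blast
    have three: "{1..3} = {1, 2, 3 :: nat}" by auto
    have dims: "ncols AC6 = 3" "ncols ?G = N" by (simp_all add: AC6_def line_copies_def)
    have im: "f ` {1, 2, 3} \<subseteq> {1..N}" and inj: "inj_on f {1, 2, 3}"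
      and ed: "\<And>x y x' y'. {(x, y), (x', y')} \<in> edges AC6 \<Longrightarrow>
        {(f x, g y), (f x', g y')} \<in> edges ?G"
      using emb unfolding grid_embedding_def dims three by blast+
    have ne: "f 1 \<noteq> f 2" "f 2 \<noteq> f 3" "f 3 \<noteq> f 1" using inj by auto
    \<comment> \<open>The row edges of \<open>AC6\<close> join columns 1 and 2, 2 and 3, 3 and 1.
      They lie in different rows, but all rows carry the same graph \<open>E\<close>.\<close>
    have "{f 1, f 2} \<in> E" using ed[of 1 1 2 1] row_edge_line_copies ne by (auto simp: AC6_def)
    moreover have "{f 2, f 3} \<in> E"
      using ed[of 2 2 3 2] row_edge_line_copies ne by (auto simp: AC6_def)
    moreover have "{f 3, f 1} \<in> E"
      using ed[of 3 3 1 3] row_edge_line_copies ne by (auto simp: AC6_def)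
    ultimately have "clique {f 1, f 2, f 3} E"
      by (auto simp: clique_def insert_commute)
    moreover have "card {f 1, f 2, f 3} = 3" using ne by auto
    ultimately show ?thesis using im by (intro disjI1 exI[of _ "{f 1, f 2, f 3}"]) auto
  next
    assume "\<exists>S. coclique ?G k S"
    then obtain S where S: "S \<subseteq> {1..N} \<times> {1..N}" "card S = k" "indep S (edges ?G)"
      and line: "(\<exists>x. \<forall>v\<in>S. fst v = x) \<or> (\<exists>y. \<forall>v\<in>S. snd v = y)"
      unfolding coclique_def by (auto simp: line_copies_def)
    from line have "\<exists>T\<subseteq>{1..N}. card T = k \<and> indep T E"
    proof
      assume "\<exists>x. \<forall>v\<in>S. fst v = x"
      then obtain x where x: "\<forall>v\<in>S. fst v = x" by blast
      have "inj_on snd S" using x by (auto simp: inj_on_def prod_eq_iff)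
      then have "card (snd ` S) = k" using S(2) card_image by blast
      moreover have "indep (snd ` S) E"
        unfolding indep_def
      proof (intro ballI impI)
        fix y y' assume "y \<in> snd ` S" "y' \<in> snd ` S" "y \<noteq> y'"
        then have "(x, y) \<in> S" "(x, y') \<in> S" using x by force+
        \<comment> \<open>Only columns inside the grid carry a copy of \<open>E\<close>, so the
          range of \<open>x\<close> matters; it comes from a point of \<open>S\<close>.\<close>
        then have "{(x, y), (x, y')} \<notin> edges ?G" "x \<in> {1..N}"
          using S \<open>y \<noteq> y'\<close> unfolding indep_def by auto
        then show "{y, y'} \<notin> E" by (auto simp: line_copies_def)
      qed
      ultimately show ?thesis using S(1) by (intro exI[of _ "snd ` S"]) auto
    next
      assume "\<exists>y. \<forall>v\<in>S. snd v = y"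
      then obtain y where y: "\<forall>v\<in>S. snd v = y" by blast
      have "inj_on fst S" using y by (auto simp: inj_on_def prod_eq_iff)
      then have "card (fst ` S) = k" using S(2) card_image by blast
      moreover have "indep (fst ` S) E"
        unfolding indep_def
      proof (intro ballI impI)
        fix x x' assume "x \<in> fst ` S" "x' \<in> fst ` S" "x \<noteq> x'"
        then have "(x, y) \<in> S" "(x', y) \<in> S" using y by force+
        then have "{(x, y), (x', y)} \<notin> edges ?G" "y \<in> {1..N}"
          using S \<open>x \<noteq> x'\<close> unfolding indep_def by auto
        then show "{x, x'} \<notin> E" by (auto simp: line_copies_def)
      qed
      ultimately show ?thesis using S(1) by (intro exI[of _ "fst ` S"]) auto
    qed
    then show ?thesis by blast
  qed
qed

theorem theorem4p3:
  shows "\<exists>c' :: real. \<forall>k :: nat. k > 0 \<longrightarrow>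
           ramsey_number 3 k \<le> gr AC6 k \<and>
           ereal_of_enat (gr AC6 k) \<le> ereal (c' * real k ^ 3)"
\<comment> \<open>The constant stays open here and becomes the 128 of
  \<open>grid_ramsey_property_AC6\<close> in the last \<open>show\<close>.\<close>
proof (intro exI allI impI conjI)
  fix k :: nat assume k: "k > 0"
  show "ramsey_number 3 k \<le> gr AC6 k"
    unfolding ramsey_number_def gr_def
    using ramsey_property_of_grid_ramsey_property by (intro Inf_superset_mono) auto
  have "gr AC6 k \<le> enat (128 * k ^ 3)"
    unfolding gr_def using grid_ramsey_property_AC6[OF k] by (intro Inf_lower) blast
  then have "ereal_of_enat (gr AC6 k) \<le> ereal_of_enat (enat (128 * k ^ 3))"
    by (simp only: ereal_of_enat_le_iff)
  also have "\<dots> = ereal (128 * real k ^ 3)" by simp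
  finally show "ereal_of_enat (gr AC6 k) \<le> ereal (128 * real k ^ 3)" .
qed

end
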